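(* Let $X,Y$ be sets with $2\leq|X|<\aleph_0$ and $2\leq|Y|\leq\aleph_0$, let $\xi=\min(|X|,|Y|)$, and let $a$ be a function from $Y$ to $X$ with $\alpha=\operatorname{rank}(a)<\xi$. Then $$\operatorname{rank}(\mathcal T_{XY}^a)=\sum_{\mu=\alpha+1}^{\xi}\mu!\binom{|Y|}{\mu}S(|X|,\mu).$$
   Context: Maps are written on the right and composed left to right. $\mathcal T_{XY}$ is the set of all (totally defined) functions $X\to Y$; $\mathcal T_{XY}^a$ is the sandwich semigroup $(\mathcal T_{XY},\star_a)$ with $f\star_ag=fag$. For a function, $\operatorname{rank}(a)=|\operatorname{im}(a)|$; for a semigroup $T$, $\operatorname{rank}(T)$ is the least cardinality of a generating set (as a semigroup). $\binom{\kappa}{\mu}$ is the number of subsets of size $\mu$ of a set of size $\kappa$ (so it is $\aleph_0$ when $\kappa=\aleph_0$ and $1\leq\mu<\aleph_0$), and $S(n,\mu)$ is the number of equivalence relations with exactly $\mu$ classes on a set of size $n$. *)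

theory Defs
  imports "HOL-Library.FuncSet" "HOL-Library.Countable_Set"
begin

unbundle cardinal_syntax

text \<open>
  A semigroup is given by its carrier \<open>S\<close> and its operation \<open>f\<close>. Cardinals are those of
  \<^theory>\<open>HOL.BNF_Cardinal_Order_Relation\<close>; a natural number \<open>n\<close> is the
  cardinal \<^term>\<open>natLeq_on n\<close>.
\<close>

inductive_set generated_subsemigroup :: "('s \<Rightarrow> 's \<Rightarrow> 's) \<Rightarrow> 's set \<Rightarrow> 's set"
  for f :: "'s \<Rightarrow> 's \<Rightarrow> 's" and A :: "'s set" where
  incl: "x \<in> A \<Longrightarrow> x \<in> generated_subsemigroup f A"
| mult: "x \<in> generated_subsemigroup f A \<Longrightarrow> y \<in> generated_subsemigroup f A \<Longrightarrow>
           f x y \<in> generated_subsemigroup f A"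

definition generates_semigroup :: "'s set \<Rightarrow> ('s \<Rightarrow> 's \<Rightarrow> 's) \<Rightarrow> 's set \<Rightarrow> bool" where
  "generates_semigroup S f A \<longleftrightarrow> A \<subseteq> S \<and> generated_subsemigroup f A = S"

definition semigroup_rank :: "'s set \<Rightarrow> ('s \<Rightarrow> 's \<Rightarrow> 's) \<Rightarrow> 's rel" where
  "semigroup_rank S f =
     |SOME A. generates_semigroup S f A \<and> (\<forall>B. generates_semigroup S f B \<longrightarrow> |A| \<le>o |B| )|"

text \<open>The choice is well defined: a closed carrier generates itself and cardinals are well ordered.\<close>

lemma semigroup_rank_least:
  assumes closed: "\<And>x y. x \<in> S \<Longrightarrow> y \<in> S \<Longrightarrow> f x y \<in> S"
  shows "\<exists>A. generates_semigroup S f A \<and> |A| = semigroup_rank S f"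
    and "generates_semigroup S f B \<Longrightarrow> semigroup_rank S f \<le>o |B|"
proof -
  let ?P = "\<lambda>A. generates_semigroup S f A \<and> (\<forall>B. generates_semigroup S f B \<longrightarrow> |A| \<le>o |B| )"
  have "x \<in> S" if "x \<in> generated_subsemigroup f S" for x
    using that by induction (auto intro: closed)
  then have "generates_semigroup S f S"
    by (auto simp: generates_semigroup_def intro: generated_subsemigroup.incl)
  then have "\<exists>r \<in> card_of ` Collect (generates_semigroup S f).
      \<forall>r' \<in> card_of ` Collect (generates_semigroup S f). r \<le>o r'"
    by (intro exists_minim_Card_order) (auto simp: card_of_Card_order)
  then have "\<exists>A. ?P A" by auto
  then have P: "?P (SOME A. ?P A)" by (rule someI_ex)
  show "\<exists>A. generates_semigroup S f A \<and> |A| = semigroup_rank S f"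
    using P unfolding semigroup_rank_def by blast
  show "generates_semigroup S f B \<Longrightarrow> semigroup_rank S f \<le>o |B|"
    using P unfolding semigroup_rank_def by blast
qed

text \<open>
  The functions from \<open>X\<close> to \<open>Y\<close> are the extensional ones, so that two functions
  agreeing on \<open>X\<close> are equal. Maps are written on the right in the product
  \<open>g \<star>\<^sub>a h = g a h\<close>: first \<open>g\<close>, then \<open>a\<close>, then \<open>h\<close>.
\<close>

definition full_maps :: "'x set \<Rightarrow> 'y set \<Rightarrow> ('x \<Rightarrow> 'y) set" where
  "full_maps X Y = X \<rightarrow>\<^sub>E Y"

definition sandwich :: "'x set \<Rightarrow> ('y \<Rightarrow> 'x) \<Rightarrow> ('x \<Rightarrow> 'y) \<Rightarrow> ('x \<Rightarrow> 'y) \<Rightarrow> ('x \<Rightarrow> 'y)" where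
  "sandwich X a g h = compose X h (compose X a g)"

lemma sandwich_closed:
  assumes "a \<in> full_maps Y X" "g \<in> full_maps X Y" "h \<in> full_maps X Y"
  shows "sandwich X a g h \<in> full_maps X Y"
  using assms unfolding full_maps_def sandwich_def compose_def by (fastforce simp: PiE_iff)

lemma sandwich_assoc:
  assumes "a \<in> full_maps Y X" "g \<in> full_maps X Y" "h \<in> full_maps X Y" "k \<in> full_maps X Y"
  shows "sandwich X a (sandwich X a g h) k = sandwich X a g (sandwich X a h k)"
  using assms by (auto simp: full_maps_def sandwich_def compose_def restrict_def fun_eq_iff PiE_iff)

text \<open>Here \<open>\<kappa>\<close> is a possibly infinite cardinal, whose \<^const>\<open>Field\<close> is a set of that size.\<close>

definition cardinal_binomial :: "'a rel \<Rightarrow> nat \<Rightarrow> 'a set rel" where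
  "cardinal_binomial \<kappa> \<mu> = |{B. B \<subseteq> Field \<kappa> \<and> finite B \<and> card B = \<mu>}|"

definition num_equivs :: "nat \<Rightarrow> nat \<Rightarrow> nat" where
  "num_equivs n \<mu> = card {r. equiv {..<n} r \<and> card ({..<n} // r) = \<mu>}"

end

theory Submission
  imports Defs "HOL-Library.Countable_Set_Type" "HOL-Analysis.Finite_Cartesian_Product"
begin

text \<open>
  A product \<open>f a g\<close> has rank at most \<open>\<alpha>\<close>, so every generating set contains the set \<open>M\<close> of all
  maps of rank greater than \<open>\<alpha>\<close>. If \<open>Y\<close> is infinite, \<open>M\<close> is as large as the whole semigroup.
  If \<open>Y\<close> is finite, \<open>M\<close> generates: since \<open>a\<close> is neither injective nor surjective, a map of rank
  \<open>r \<le> \<alpha>\<close> is a product of two maps of rank greater than \<open>r\<close>. Finally, a map of rank \<open>\<mu>\<close> amounts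
  to an image, a kernel with \<open>\<mu>\<close> classes, and a bijection from the classes to the image.
\<close>

section \<open>Counting maps onto a finite set by their kernels\<close>

lemma card_inj_PiE_eq_card:
  assumes "finite C" "finite B" "card C = card B"
  shows "card {g \<in> C \<rightarrow>\<^sub>E B. inj_on g C} = fact (card B)"
  using card_inj_on_subset_funcset[OF assms(1,2) subset_refl] assms(3)
  by (simp add: fact_prod_rev)

definition kernel_on :: "'a set \<Rightarrow> ('a \<Rightarrow> 'b) \<Rightarrow> ('a \<times> 'a) set" where
  "kernel_on A f = {(x, y). x \<in> A \<and> y \<in> A \<and> f x = f y}"

lemma equiv_kernel_on: "equiv A (kernel_on A f)"
  by (auto simp: kernel_on_def equiv_def refl_on_def sym_def trans_def)

text \<open>This is the factorization of \<open>f\<close> through its kernel: \<open>f\<close> is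
  constant on each class \<open>c\<close>, the image of \<open>c\<close> is a singleton, and
  \<open>the_elem\<close> reads off its value.\<close>

lemma bij_betw_quotient_kernel_on: "bij_betw (\<lambda>c. the_elem (f ` c)) (A // kernel_on A f) (f ` A)"
proof -
  have fc: "f ` (kernel_on A f `` {x}) = {f x}" if "x \<in> A" for x
    using that by (auto simp: kernel_on_def)
  have te: "the_elem (f ` (kernel_on A f `` {x})) = f x" if "x \<in> A" for x
    using fc[OF that] by simp
  have "inj_on (\<lambda>c. the_elem (f ` c)) (A // kernel_on A f)"
    by (rule inj_onI, elim quotientE) (auto simp: te, auto simp: kernel_on_def)
  moreover have "(\<lambda>c. the_elem (f ` c)) ` (A // kernel_on A f) = f ` A"
    unfolding quotient_def image_UN by (simp add: te UNION_singleton_eq_range)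
  ultimately show ?thesis by (simp add: bij_betw_def)
qed

text \<open>Composing with the projection of \<open>A\<close> to \<open>A // r\<close> turns
  injections \<open>A // r\<close> to \<open>B\<close> into maps with kernel exactly
  \<open>r\<close>. As both sides have the same finite size, these injections are onto
  \<open>B\<close>, and there are \<open>fact (card B)\<close> of them.\<close>

lemma card_surj_PiE_with_kernel:
  assumes A: "finite A" and B: "finite B" and r: "equiv A r" and c: "card (A // r) = card B"
  shows "card {f \<in> A \<rightarrow>\<^sub>E B. f ` A = B \<and> kernel_on A f = r} = fact (card B)"
proof -
  let ?\<Phi> = "\<lambda>g. \<lambda>x\<in>A. g (r `` {x})"
  let ?I = "{g \<in> A // r \<rightarrow>\<^sub>E B. inj_on g (A // r)}"
  let ?F = "{f \<in> A \<rightarrow>\<^sub>E B. f ` A = B \<and> kernel_on A f = r}"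
  have fin: "finite (A // r)" using A r by (simp add: equiv_type finite_quotient)
  have cls: "r `` {x} = r `` {y} \<longleftrightarrow> (x, y) \<in> r" if "x \<in> A" "y \<in> A" for x y
    using that r by (simp add: eq_equiv_class_iff)
  have rA: "x \<in> A \<and> y \<in> A" if "(x, y) \<in> r" for x y
    using that r by (meson equiv_class_eq_iff)
  have inj: "inj_on ?\<Phi> ?I"
  proof (rule inj_onI)
    fix g g' assume g: "g \<in> ?I" "g' \<in> ?I" "?\<Phi> g = ?\<Phi> g'"
    show "g = g'"
    proof (rule PiE_ext)
      show "g \<in> A // r \<rightarrow>\<^sub>E B" "g' \<in> A // r \<rightarrow>\<^sub>E B" using g by auto
      fix c assume "c \<in> A // r"
      then obtain x where "x \<in> A" "c = r `` {x}" by (auto elim: quotientE)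
      then show "g c = g' c" using fun_cong[OF g(3), of x] by simp
    qed
  qed
  have sub: "?\<Phi> g \<in> ?F" if g: "g \<in> ?I" for g
  proof -
    have "g ` (A // r) = B"
      using g B c by (intro card_subset_eq) (auto simp: card_image)
    moreover have "?\<Phi> g ` A = g ` (A // r)" by (auto simp: quotient_def)
    moreover have "kernel_on A (?\<Phi> g) = r"
    proof -
      have "g (r `` {x}) = g (r `` {y}) \<longleftrightarrow> (x, y) \<in> r" if "x \<in> A" "y \<in> A" for x y
        using g that cls[OF that] by (auto dest: inj_onD intro!: quotientI)
      then show ?thesis using rA by (auto simp: kernel_on_def)
    qed
    ultimately show ?thesis using g by (auto intro!: quotientI)
  qed
  have sup: "f \<in> ?\<Phi> ` ?I" if f: "f \<in> ?F" for f
  proof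
    define g where "g = (\<lambda>c\<in>A // r. the_elem (f ` c))"
    have bij: "bij_betw (\<lambda>c. the_elem (f ` c)) (A // r) B"
      using bij_betw_quotient_kernel_on[of f A] f by auto
    have gr: "g (r `` {x}) = f x" if "x \<in> A" for x
    proof -
      have "f ` (r `` {x}) = {f x}" using f that by (auto simp: kernel_on_def)
      then show ?thesis using that by (simp add: g_def quotientI)
    qed
    show "f = ?\<Phi> g"
      by (rule extensionalityI[of _ A]) (use f gr in \<open>auto simp: PiE_def\<close>)
    show "g \<in> ?I" using bij by (auto simp: g_def bij_betw_def)
  qed
  have "bij_betw ?\<Phi> ?I ?F"
    by (rule bij_betw_imageI[OF inj subset_antisym[OF image_subsetI[OF sub] subsetI[OF sup]]])
  from bij_betw_same_card[OF this] show ?thesis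
    by (simp only: card_inj_PiE_eq_card[OF fin B c])
qed

text \<open>The surjections are split by kernel, and every admissible kernel contributes the same
  number. The domain is an initial segment because \<open>num_equivs\<close> counts equivalences
  there.\<close>

lemma card_surj_PiE_lessThan:
  assumes B: "finite B"
  shows "card {f \<in> {..<n} \<rightarrow>\<^sub>E B. f ` {..<n} = B} = fact (card B) * num_equivs n (card B)"
proof -
  let ?A = "{..<n}"
  let ?E = "{r. equiv ?A r \<and> card (?A // r) = card B}"
  let ?F = "\<lambda>r. {f \<in> ?A \<rightarrow>\<^sub>E B. f ` ?A = B \<and> kernel_on ?A f = r}"
  have "finite ?E"
    by (rule finite_subset[of _ "Pow (?A \<times> ?A)"]) (auto simp: equiv_type dest: equiv_type)
  moreover have "finite (?F r)" for r
    by (rule finite_subset[of _ "?A \<rightarrow>\<^sub>E B"]) (auto intro: finite_PiE B)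
  moreover have "{f \<in> ?A \<rightarrow>\<^sub>E B. f ` ?A = B} = (\<Union>r\<in>?E. ?F r)"
    \<comment> \<open>The kernel of a surjection onto \<open>B\<close> lies in \<open>?E\<close>:
      its classes are in bijection with the image \<open>B\<close>.\<close>
    using bij_betw_same_card[OF bij_betw_quotient_kernel_on[of _ ?A]]
    by (auto simp: equiv_kernel_on)
  ultimately have "card {f \<in> ?A \<rightarrow>\<^sub>E B. f ` ?A = B} = (\<Sum>r\<in>?E. card (?F r))"
    by (simp only:) (rule card_UN_disjoint; auto)
  also have "\<dots> = (\<Sum>r\<in>?E. fact (card B))"
    by (rule sum.cong) (auto intro: card_surj_PiE_with_kernel B)
  finally show ?thesis by (simp add: num_equivs_def)
qed

lemma PiE_iff_image_subset: "f \<in> A \<rightarrow>\<^sub>E B \<longleftrightarrow> f ` A \<subseteq> B \<and> f \<in> extensional A"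
  by (auto simp: PiE_def)

text \<open>An enumeration \<open>e\<close> of \<open>X\<close> transports the count from the
  initial segment: precomposing with \<open>e\<close> or its inverse preserves the image.\<close>

lemma card_surj_PiE:
  assumes X: "finite X" and B: "finite B"
  shows "card {f \<in> X \<rightarrow>\<^sub>E B. f ` X = B} = fact (card B) * num_equivs (card X) (card B)"
proof -
  let ?n = "{..<card X}"
  obtain e where e: "bij_betw e ?n X"
    using bij_betw_from_nat_into_finite[OF X] by blast
  have "bij_betw (\<lambda>f. compose ?n f e) {f \<in> X \<rightarrow>\<^sub>E B. f ` X = B} {f \<in> ?n \<rightarrow>\<^sub>E B. f ` ?n = B}"
  proof (rule bij_betw_byWitness[where f' = "\<lambda>f. compose X f (inv_into ?n e)"])
    let ?i = "inv_into ?n e"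
    have i: "bij_betw ?i X ?n" using e by (rule bij_betw_inv_into)
    have ei: "e (?i x) = x" "?i x \<in> ?n" if "x \<in> X" for x
      using bij_betw_inv_into_right[OF e that] bij_betwE[OF i] that by auto
    have ie: "?i (e k) = k" "e k \<in> X" if "k \<in> ?n" for k
      using bij_betw_inv_into_left[OF e that] bij_betwE[OF e] that by auto
    show "\<forall>f\<in>{f \<in> X \<rightarrow>\<^sub>E B. f ` X = B}. compose X (compose ?n f e) ?i = f"
      using ei by (auto simp: compose_def PiE_def extensional_def fun_eq_iff)
    show "\<forall>f\<in>{f \<in> ?n \<rightarrow>\<^sub>E B. f ` ?n = B}. compose ?n (compose X f ?i) e = f"
      using ie by (auto simp: compose_def PiE_def extensional_def fun_eq_iff)
    have im: "compose ?n f e ` ?n = f ` X" "compose X f' ?i ` X = f' ` ?n"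
      for f :: "'a \<Rightarrow> 'b" and f' :: "nat \<Rightarrow> 'b"
      by (rule surj_compose[OF bij_betw_imp_surj_on[OF e] refl],
          rule surj_compose[OF bij_betw_imp_surj_on[OF i] refl])
    then show "(\<lambda>f. compose ?n f e) ` {f \<in> X \<rightarrow>\<^sub>E B. f ` X = B} \<subseteq> {f \<in> ?n \<rightarrow>\<^sub>E B. f ` ?n = B}"
      and "(\<lambda>f. compose X f ?i) ` {f \<in> ?n \<rightarrow>\<^sub>E B. f ` ?n = B} \<subseteq> {f \<in> X \<rightarrow>\<^sub>E B. f ` X = B}"
      by (intro image_subsetI CollectI; simp add: PiE_iff_image_subset im)+
  qed
  from bij_betw_same_card[OF this] show ?thesis
    by (simp only: card_surj_PiE_lessThan[OF B])
qed

section \<open>The cardinal of the set of maps of large rank\<close>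

text \<open>Pairing \<open>f\<close> with its image gives a disjoint union over the possible images
  \<open>B\<close>, whose fibres all have the size of \<open>?K \<times> ?E\<close>. The factors are
  ordered, and written as initial segments, so that they are the fields of the cardinals multiplied
  in the final formula.\<close>

lemma card_of_rank_eq:
  assumes X: "finite X"
  shows "|{f \<in> X \<rightarrow>\<^sub>E Y. card (f ` X) = \<mu>}|
    =o |{k. k < (fact \<mu> :: nat)} \<times> {B. B \<subseteq> Y \<and> finite B \<and> card B = \<mu>} \<times> {k. k < num_equivs (card X) \<mu>}|"
    (is "|?F| =o |?K \<times> ?B \<times> ?E|")
proof -
  let ?S = "\<lambda>B. {f \<in> X \<rightarrow>\<^sub>E B. f ` X = B}"
  have "bij_betw (\<lambda>f. (f ` X, f)) ?F (SIGMA B:?B. ?S B)"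
    unfolding bij_betw_def using X by (auto simp: inj_on_def PiE_def image_def)
  then have "|?F| =o |SIGMA B:?B. ?S B|" by (rule card_of_ordIsoI)
  also have "|SIGMA B:?B. ?S B| =o |?B \<times> (?K \<times> ?E)|"
  proof (rule card_of_Sigma_cong1, rule ballI)
    fix B assume B: "B \<in> ?B"
    have "finite (?S B)"
      by (rule finite_subset[of _ "X \<rightarrow>\<^sub>E B"]) (use B X in \<open>auto intro: finite_PiE\<close>)
    moreover have "card (?S B) = card (?K \<times> ?E)"
      using card_surj_PiE[OF X, of B] B by simp
    ultimately obtain \<phi> where "bij_betw \<phi> (?S B) (?K \<times> ?E)"
      using finite_same_card_bij[of "?S B" "?K \<times> ?E"] by auto
    then show "|?S B| =o |?K \<times> ?E|" by (rule card_of_ordIsoI)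
  qed
  also have "|?B \<times> (?K \<times> ?E)| =o |?K \<times> ?B \<times> ?E|"
    by (rule card_of_ordIsoI[of "\<lambda>(B, k, e). (k, B, e)"]) (auto simp: bij_betw_def inj_on_def image_def)
  finally show ?thesis .
qed

lemma card_of_rank_gt:
  assumes X: "finite X" and \<xi>: "\<And>f. f \<in> X \<rightarrow>\<^sub>E Y \<Longrightarrow> card (f ` X) \<le> \<xi>"
  shows "|{f \<in> X \<rightarrow>\<^sub>E Y. \<alpha> < card (f ` X)}| =o
    (CSUM \<mu> : |{\<alpha> + 1..\<xi>}|.
       natLeq_on (fact \<mu>) *c cardinal_binomial |Y| \<mu> *c natLeq_on (num_equivs (card X) \<mu>))"
proof -
  let ?F = "\<lambda>\<mu>. {f \<in> X \<rightarrow>\<^sub>E Y. card (f ` X) = \<mu>}"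
  have "bij_betw (\<lambda>f. (card (f ` X), f)) {f \<in> X \<rightarrow>\<^sub>E Y. \<alpha> < card (f ` X)} (SIGMA \<mu>:{\<alpha> + 1..\<xi>}. ?F \<mu>)"
    unfolding bij_betw_def using \<xi> by (auto simp: inj_on_def image_def)
  then have "|{f \<in> X \<rightarrow>\<^sub>E Y. \<alpha> < card (f ` X)}| =o |SIGMA \<mu>:{\<alpha> + 1..\<xi>}. ?F \<mu>|"
    by (rule card_of_ordIsoI)
  also have "|SIGMA \<mu>:{\<alpha> + 1..\<xi>}. ?F \<mu>| =o |SIGMA \<mu>:{\<alpha> + 1..\<xi>}. {k. k < (fact \<mu> :: nat)}
      \<times> {B. B \<subseteq> Y \<and> finite B \<and> card B = \<mu>} \<times> {k. k < num_equivs (card X) \<mu>}|"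
    by (intro card_of_Sigma_cong1 ballI card_of_rank_eq X)
  finally show ?thesis
    unfolding Csum_def cprod_def cardinal_binomial_def
    by (simp only: Field_card_of Field_natLeq_on)
qed

section \<open>Ranks of products and generation by maps of large rank\<close>

lemma sandwich_apply: "x \<in> X \<Longrightarrow> sandwich X a g h x = h (a (g x))"
  by (simp add: sandwich_def compose_def)

lemma sandwich_rank_le:
  assumes a: "finite (a ` Y)" and g: "g \<in> full_maps X Y"
  shows "card (sandwich X a g h ` X) \<le> card (a ` Y)"
proof -
  have "sandwich X a g h ` X \<subseteq> h ` (a ` Y)"
    using g by (auto simp: sandwich_apply full_maps_def)
  then have "card (sandwich X a g h ` X) \<le> card (h ` (a ` Y))"
    using a by (intro card_mono) auto
  also have "\<dots> \<le> card (a ` Y)" using a by (rule card_image_le)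
  finally show ?thesis .
qed

text \<open>An element of the generated subsemigroup is a generator or a product, and the rank bound
  excludes products.\<close>

lemma rank_gt_subset_generators:
  assumes gen: "generates_semigroup (full_maps X Y) (sandwich X a) A" and a: "finite (a ` Y)"
  shows "{f \<in> full_maps X Y. card (a ` Y) < card (f ` X)} \<subseteq> A"
proof
  fix f assume f: "f \<in> {f \<in> full_maps X Y. card (a ` Y) < card (f ` X)}"
  have G: "generated_subsemigroup (sandwich X a) A = full_maps X Y"
    using gen by (simp add: generates_semigroup_def)
  then have "f \<in> generated_subsemigroup (sandwich X a) A" using f by simp
  then show "f \<in> A"
  proof cases
    case (mult g h)
    then have "card (f ` X) \<le> card (a ` Y)" using sandwich_rank_le[OF a, of g X h] G by simp
    then show ?thesis using f by simp
  qed
qed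

text \<open>An injection \<open>c\<close> of the image of \<open>f\<close> into the image of
  \<open>a\<close> routes \<open>f\<close> through \<open>a\<close>: \<open>g\<close> lifts
  \<open>c\<close> after \<open>f\<close> along \<open>a\<close>, and \<open>h\<close> undoes
  \<open>c\<close>. The rank of \<open>g\<close> is raised by hitting two points that
  \<open>a\<close> identifies, that of \<open>h\<close> by sending a point outside the image of
  \<open>c\<close> to a value that \<open>f\<close> misses.\<close>

lemma sandwich_factorization:
  assumes X: "finite X" and Y: "finite Y" and a: "a \<in> full_maps Y X"
    and aX: "card (a ` Y) < card X" and aY: "card (a ` Y) < card Y"
    and f: "f \<in> full_maps X Y" and r: "card (f ` X) \<le> card (a ` Y)"
  obtains g h where "g \<in> full_maps X Y" "h \<in> full_maps X Y" "f = sandwich X a g h"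
    "card (f ` X) < card (g ` X)" "card (f ` X) < card (h ` X)"
proof -
  have fXY: "f ` X \<subseteq> Y" "f \<in> extensional X" using f by (auto simp: full_maps_def PiE_def)
  have aYX: "a ` Y \<subseteq> X" using a by (auto simp: full_maps_def)
  have "\<not> inj_on f X" using r aX by (auto dest: card_image)
  then obtain p q where pq: "p \<in> X" "q \<in> X" "p \<noteq> q" "f p = f q" by (auto simp: inj_on_def)
  have "\<not> inj_on a Y" using aY by (auto dest: card_image)
  then obtain z z' where z: "z \<in> Y" "z' \<in> Y" "z \<noteq> z'" "a z = a z'" by (auto simp: inj_on_def)
  \<comment> \<open>Removing one point on each side leaves room to prescribe
    \<open>c (f p) = a z\<close>, so that the two points \<open>p\<close>, \<open>q\<close>
    identified by \<open>f\<close> can be sent to the two points \<open>z'\<close>, \<open>z\<close>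
    identified by \<open>a\<close>.\<close>
  have "card (f ` X - {f p}) \<le> card (a ` Y - {a z})"
    using r pq z X Y by (auto simp: card_Diff_singleton)
  then obtain b where b: "inj_on b (f ` X - {f p})" "b ` (f ` X - {f p}) \<subseteq> a ` Y - {a z}"
    using card_le_inj[of "f ` X - {f p}" "a ` Y - {a z}"] X Y by auto
  define c where "c = b(f p := a z)"
  have cp: "c (f p) = a z" by (simp add: c_def)
  have c_inj: "inj_on c (f ` X)"
  proof -
    have "inj_on c (f ` X - {f p}) \<longleftrightarrow> inj_on b (f ` X - {f p})"
      by (rule inj_on_cong) (simp add: c_def)
    moreover have "c ` (f ` X - {f p}) = b ` (f ` X - {f p})" by (auto simp: c_def)
    then have "c (f p) \<notin> c ` (f ` X - {f p})" using b(2) cp by auto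
    ultimately have "inj_on c (insert (f p) (f ` X - {f p}))"
      unfolding inj_on_insert Diff_idemp using b(1) by blast
    then show ?thesis by (rule inj_on_subset) blast
  qed
  have c_im: "c ` f ` X \<subseteq> a ` Y" using b z by (auto simp: c_def)
  let ?T = "c ` f ` X"
  have cT: "card ?T = card (f ` X)" using c_inj by (rule card_image)
  have "f ` X \<noteq> Y" using r aY by auto
  then obtain w where w: "w \<in> Y" "w \<notin> f ` X" using fXY by auto
  have "?T \<noteq> X" using cT r aX by auto
  then obtain u where u: "u \<in> X" "u \<notin> ?T" using c_im aYX by blast
  \<comment> \<open>The special values occur only where \<open>f x = f p\<close>, and there both
    \<open>z\<close> and \<open>z'\<close> are lifts of \<open>c (f p)\<close>. The point
    \<open>q\<close> takes the value \<open>z\<close>, so both are attained.\<close>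
  define g where "g = (\<lambda>x\<in>X. if x = p then z' else if f x = f p then z else inv_into Y a (c (f x)))"
  \<comment> \<open>Points outside \<open>?T\<close>, among them \<open>u\<close>, go to
    \<open>w\<close>, which is not a value of \<open>f\<close>.\<close>
  define h where "h = (\<lambda>x\<in>X. if x \<in> ?T then inv_into (f ` X) c x else w)"
  have g: "g \<in> full_maps X Y"
    using z c_im by (auto simp: g_def full_maps_def image_subset_iff intro!: inv_into_into)
  have hT: "h (c (f x)) = f x" if "x \<in> X" for x
    using that c_inj c_im aYX by (auto simp: h_def image_subset_iff)
  have h: "h \<in> full_maps X Y"
  proof -
    have "inv_into (f ` X) c x \<in> Y" if "x \<in> ?T" for x
      using inv_into_into[OF that] fXY by auto
    then show ?thesis using w by (auto simp: h_def full_maps_def)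
  qed
  have ag: "a (g x) = c (f x)" if "x \<in> X" for x
    using that z cp c_im by (auto simp: g_def f_inv_into_f image_subset_iff)
  have "f = sandwich X a g h"
    by (rule extensionalityI[of _ X])
      (use fXY ag hT in \<open>auto simp: sandwich_apply, auto simp: sandwich_def\<close>)
  moreover have "card (f ` X) < card (g ` X)"
  proof -
    have "a ` g ` X = ?T" using ag by (auto simp: image_image)
    moreover have "z' \<in> g ` X" "z \<in> g ` X"
      using pq by (auto simp: g_def intro!: image_eqI[of _ _ p] image_eqI[of _ _ q])
    \<comment> \<open>Applying \<open>a\<close> to the image of \<open>g\<close> loses at least one
      point and still leaves \<open>?T\<close>, which has the rank of \<open>f\<close> as its
      size.\<close>
    then have "\<not> inj_on a (g ` X)" using z by (auto simp: inj_on_def)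
    then have "card (a ` g ` X) < card (g ` X)"
      using X by (meson card_image_le eq_card_imp_inj_on finite_imageI le_neq_implies_less)
    ultimately show ?thesis using cT by simp
  qed
  moreover have "card (f ` X) < card (h ` X)"
  proof -
    have "f x \<in> h ` X" if "x \<in> X" for x
      using hT[OF that] that c_im aYX by (intro image_eqI[of _ _ "c (f x)"]) auto
    moreover have "w \<in> h ` X" using u by (auto simp: h_def intro!: image_eqI[of _ _ u])
    ultimately have "f ` X \<subset> h ` X" using w by blast
    then show ?thesis using X by (simp add: psubset_card_mono)
  qed
  ultimately show thesis using that g h by blast
qed

lemma rank_gt_generates:
  assumes "finite X" "finite Y" and a: "a \<in> full_maps Y X"
    and "card (a ` Y) < card X" "card (a ` Y) < card Y"
  shows "generates_semigroup (full_maps X Y) (sandwich X a)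
    {f \<in> full_maps X Y. card (a ` Y) < card (f ` X)}" (is "generates_semigroup ?S ?m ?M")
proof -
  have "f \<in> ?S" if "f \<in> generated_subsemigroup ?m ?M" for f
    using that by induction (auto intro: sandwich_closed[OF a])
  moreover have "f \<in> generated_subsemigroup ?m ?M" if "f \<in> ?S" for f
    using that
  \<comment> \<open>The induction goes downward on rank: both factors have larger rank than
    \<open>f\<close>.\<close>
  proof (induction "card X - card (f ` X)" arbitrary: f rule: less_induct)
    case less
    show ?case
    proof (cases "card (a ` Y) < card (f ` X)")
      case True
      then show ?thesis using less.prems by (auto intro: generated_subsemigroup.incl)
    next
      case False
      then obtain g h where gh: "g \<in> ?S" "h \<in> ?S" "f = ?m g h"
        "card (f ` X) < card (g ` X)" "card (f ` X) < card (h ` X)"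
        using sandwich_factorization[OF assms less.prems] by (metis not_less)
      \<comment> \<open>This bound makes the truncated difference drop strictly when the rank
        rises.\<close>
      moreover have "card (k ` X) \<le> card X" for k :: "'a \<Rightarrow> 'b"
        using assms(1) by (rule card_image_le)
      ultimately have "g \<in> generated_subsemigroup ?m ?M" "h \<in> generated_subsemigroup ?m ?M"
        using less.hyps[of g] less.hyps[of h] by (meson diff_less_mono2 less_le_trans)+
      then show ?thesis using gh(3) by (auto intro: generated_subsemigroup.mult)
    qed
  qed
  ultimately show ?thesis unfolding generates_semigroup_def by blast
qed

section \<open>Infinite targets and the final comparison\<close>

text \<open>Finitely many maps on a finite set use only finitely many values, so some
  \<open>B\<close> of size \<open>card X\<close> avoids them all. A bijection from \<open>X\<close>
  to \<open>B\<close> has rank \<open>card X\<close> and would be a further member.\<close>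

lemma infinite_rank_gt:
  assumes X: "finite X" and Y: "infinite Y" and \<alpha>: "\<alpha> < card X"
  shows "infinite {f \<in> full_maps X Y. \<alpha> < card (f ` X)}" (is "infinite ?M")
proof
  assume "finite ?M"
  then have "finite (\<Union>f\<in>?M. f ` X)" using X by auto
  then have "infinite (Y - (\<Union>f\<in>?M. f ` X))" using Y by simp
  then obtain B where B: "B \<subseteq> Y - (\<Union>f\<in>?M. f ` X)" "finite B" "card B = card X"
    using infinite_arbitrarily_large[of "Y - (\<Union>f\<in>?M. f ` X)" "card X"] by auto
  then obtain e where "bij_betw e X B" using finite_same_card_bij[OF X, of B] by auto
  then have im: "restrict e X ` X = B" by (simp add: bij_betw_def)
  then have "restrict e X \<in> ?M" using B \<alpha> by (auto simp: full_maps_def)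
  then have "B \<subseteq> (\<Union>f\<in>?M. f ` X)" using im by blast
  then have "B = {}" using B by blast
  then show False using B \<alpha> by simp
qed

theorem theorem3p9:
  fixes X :: "'x set" and Y :: "'y set" and a :: "'y \<Rightarrow> 'x" and \<xi> \<alpha> :: nat
  assumes "finite X" and "2 \<le> card X"
    and "countable Y" and "infinite Y \<or> 2 \<le> card Y"
    and "\<xi> = (if finite Y then min (card X) (card Y) else card X)"
    and "a \<in> full_maps Y X"
    and "\<alpha> = card (a ` Y)"
    and "\<alpha> < \<xi>"
  shows "semigroup_rank (full_maps X Y) (sandwich X a) =o
    (CSUM \<mu> : |{\<alpha> + 1..\<xi>}|.
       natLeq_on (fact \<mu>) *c cardinal_binomial |Y| \<mu> *c natLeq_on (num_equivs (card X) \<mu>))"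
proof -
  let ?S = "full_maps X Y"
  let ?M = "{f \<in> ?S. \<alpha> < card (f ` X)}"
  note a = \<open>a \<in> full_maps Y X\<close>
  have finaY: "finite (a ` Y)"
    using a by (intro finite_subset[OF _ \<open>finite X\<close>]) (auto simp: full_maps_def)
  have least: "semigroup_rank ?S (sandwich X a) \<le>o |B|"
    if "generates_semigroup ?S (sandwich X a) B" for B
    using semigroup_rank_least(2)[OF sandwich_closed[OF a] that] .
  \<comment> \<open>The rank is realised by a least generating set \<open>A\<close>, whose cardinal
    is now compared with that of \<open>?M\<close> in both directions.\<close>
  obtain A where A: "generates_semigroup ?S (sandwich X a) A"
    "|A| = semigroup_rank ?S (sandwich X a)"
    using semigroup_rank_least(1)[of ?S "sandwich X a", OF sandwich_closed[OF a]] by blast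
  have ge: "|?M| \<le>o |A|"
    using rank_gt_subset_generators[OF A(1) finaY] \<open>\<alpha> = card (a ` Y)\<close> by (simp add: card_of_mono1)
  have le: "|A| \<le>o |?M|"
  proof (cases "finite Y")
    case True
    then show ?thesis
      using least[OF rank_gt_generates[OF \<open>finite X\<close> True a]] assms(5,7,8) A(2) by simp
  next
    case False
    \<comment> \<open>Here \<open>natLeq\<close> separates the two cardinals: \<open>A\<close> lies
      in a countable semigroup, and \<open>?M\<close> is infinite because \<alpha> is below \<xi>,
      which equals \<open>card X\<close> in this case.\<close>
    have "countable ?S"
      unfolding full_maps_def using \<open>finite X\<close> \<open>countable Y\<close> by (intro countable_PiE) auto
    moreover have "A \<subseteq> ?S" using A(1) by (simp add: generates_semigroup_def)
    ultimately have "|A| \<le>o natLeq"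
      using countable_subset countable_card_le_natLeq by blast
    moreover have "natLeq \<le>o |?M|"
      using infinite_rank_gt[OF \<open>finite X\<close> False, of \<alpha>] assms(5,8) False
        infinite_iff_natLeq_ordLeq[of ?M] by argo
    ultimately show ?thesis by (rule ordLeq_transitive)
  qed
  have "card (f ` X) \<le> \<xi>" if "f \<in> X \<rightarrow>\<^sub>E Y" for f
    using that \<open>finite X\<close> assms(5) by (auto intro!: card_image_le card_mono)
  then have "|?M| =o (CSUM \<mu> : |{\<alpha> + 1..\<xi>}|.
       natLeq_on (fact \<mu>) *c cardinal_binomial |Y| \<mu> *c natLeq_on (num_equivs (card X) \<mu>))"
    unfolding full_maps_def by (rule card_of_rank_gt[OF \<open>finite X\<close>])
  moreover have "|A| =o |?M|" using ge le by (simp add: ordIso_iff_ordLeq)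
  ultimately show ?thesis unfolding A(2)[symmetric] by (rule ordIso_transitive[rotated])
qed

end
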